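(* Let $(f, I, U)$ be a safety verification problem that is robustly safe, such that the closures $\overline{I}$ and $\overline{U}$ are disjoint, and such that the set of safe states $\mathbb{R}^n\setminus U$ is bounded. Then $(f,I,U)$ has a barrier certificate.
   Context: A safety verification problem is a triple $(f,I,U)$ with $f:\mathbb{R}^n\to\mathbb{R}^n$ smooth, $I\subseteq\mathbb{R}^n$ (initial states) and $U\subseteq\mathbb{R}^n$ (unsafe states). Convention: the flow $\varphi_f(x,t)$ of $\dot x=f(x)$ (the state reached at time $t\in\mathbb{R}$ from $x$; negative $t$ allowed) is assumed defined for all $x\in\mathbb{R}^n$, $t\in\mathbb{R}$. For $\varepsilon\ge 0$, an $\varepsilon$-solution of $\dot x=f(x)$ is a differentiable function $x:\mathbb{R}^{\ge0}\to\mathbb{R}^n$ with $\|f(x(t))-\dot x(t)\|\le\varepsilon$ for all $t\ge0$ (Euclidean norm). For $X\subseteq\mathbb{R}^n$, $T\subseteq\mathbb{R}^{\ge 0}$: $R^{T}_{f,\varepsilon}(X)=\{x(t)\mid t\in T,\ x \text{ an } \varepsilon\text{-solution with } x(0)\in X\}$, and $R_{f,\varepsilon}(X)=R^{\mathbb{R}^{\ge0}}_{f,\varepsilon}(X)$. The problem $(f,I,U)$ is robustly safe iff there is $\varepsilon>0$ with $R_{f,\varepsilon}(I)\cap U=\emptyset$; such an $\varepsilon$ is called a robustness margin. A barrier certificate of $(f,I,U)$ is a differentiable $\beta:\mathbb{R}^n\to\mathbb{R}$ such that: (i) $x\in I\Rightarrow \beta(x)\ge 0$; (ii) $\beta(x)=0\Rightarrow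 (\nabla\beta(x))^T f(x)>0$; (iii) $\beta(x)\ge 0\Rightarrow x\notin U$. *)

theory Defs
  imports "HOL-Analysis.Analysis"
begin

text \<open>C-infinity smoothness on the whole space: there are iterated (Frechet) derivatives of
all orders, D k x [v1,...,vk] being the k-th derivative at x applied to v1..vk; each is
the derivative of the previous one and all are continuous.\<close>
definition smooth :: "('a::real_normed_vector \<Rightarrow> 'b::real_normed_vector) \<Rightarrow> bool" where
  "smooth f \<longleftrightarrow> (\<exists>D :: nat \<Rightarrow> 'a \<Rightarrow> 'a list \<Rightarrow> 'b.
      (\<forall>x. D 0 x [] = f x) \<and>
      (\<forall>k vs x. length vs = k \<longrightarrow>
          ((\<lambda>y. D k y vs) has_derivative (\<lambda>h. D (Suc k) x (h # vs))) (at x)) \<and>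
      (\<forall>k vs. length vs = k \<longrightarrow> continuous_on UNIV (\<lambda>x. D k x vs)))"

definition global_flow :: "('a::real_normed_vector \<Rightarrow> 'a) \<Rightarrow> bool" where
  "global_flow f \<longleftrightarrow> (\<exists>\<phi> :: 'a \<Rightarrow> real \<Rightarrow> 'a. \<forall>x. \<phi> x 0 = x \<and>
      (\<forall>t. ((\<phi> x) has_vector_derivative f (\<phi> x t)) (at t)))"

text \<open>epsilon-solution: differentiable on [0,oo) (one-sided at 0), derivative within eps of f.
  Values at negative times are irrelevant.\<close>
definition eps_solution :: "('a::real_normed_vector \<Rightarrow> 'a) \<Rightarrow> real \<Rightarrow> (real \<Rightarrow> 'a) \<Rightarrow> bool" where
  "eps_solution f \<epsilon> x \<longleftrightarrow> (\<forall>t\<ge>0. \<exists>x'. (x has_vector_derivative x') (at t within {0..})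
      \<and> norm (f (x t) - x') \<le> \<epsilon>)"

definition reach :: "('a::real_normed_vector \<Rightarrow> 'a) \<Rightarrow> real \<Rightarrow> real set \<Rightarrow> 'a set \<Rightarrow> 'a set" where
  "reach f \<epsilon> T X = {x t | x t. t \<in> T \<and> eps_solution f \<epsilon> x \<and> x 0 \<in> X}"

definition robustly_safe :: "('a::real_normed_vector \<Rightarrow> 'a) \<Rightarrow> 'a set \<Rightarrow> 'a set \<Rightarrow> bool" where
  "robustly_safe f I U \<longleftrightarrow> (\<exists>\<epsilon>>0. reach f \<epsilon> {0..} I \<inter> U = {})"

text \<open>Barrier certificate; (\<nabla>\<beta> x)^T f x is the derivative of \<beta> at x applied to f x.\<close>
definition barrier_certificate :: "('a::euclidean_space \<Rightarrow> 'a) \<Rightarrow> 'a set \<Rightarrow> 'a set \<Rightarrow> ('a \<Rightarrow> real) \<Rightarrow> bool" where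
  "barrier_certificate f I U \<beta> \<longleftrightarrow>
     (\<forall>x. \<beta> differentiable (at x)) \<and>
     (\<forall>x\<in>I. \<beta> x \<ge> 0) \<and>
     (\<forall>x. \<beta> x = 0 \<longrightarrow> frechet_derivative \<beta> (at x) (f x) > 0) \<and>
     (\<forall>x. \<beta> x \<ge> 0 \<longrightarrow> x \<notin> U)"

end

(*
Let S be the set of states reached from I by eps/2-solutions that arrive with the velocity of
the flow. S is closed under all short steps q -> q + tau (f q + w) with |w| <= eps/4, and it has
positive distance from U: for arrival times bounded below, perturbing an eps/2-solution to an
eps-solution reaches a whole ball around q, and for short times q is still close to I. For a
fine finite net F of S, the function beta x = sum_{q in F} max(0, rho^2 - |x-q|^2)^2 - c is a
barrier: an active summand can fail to increase along f at x only if x lies in front of q, but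
then some successor of q is closer to x than rho by a fixed amount, which forces beta x > 0 when
c is small.
*)
theory Submission
  imports Defs
begin

section \<open>Barrier functions as sums of bumps around an invariant set\<close>

text \<open>Squaring removes the kink of \<open>max 0\<close>: at 0 the difference quotient is
  bounded by \<open>\<bar>h\<bar>\<close>.\<close>

lemma DERIV_max_0_squared:
  "((\<lambda>s::real. (max 0 s)\<^sup>2) has_real_derivative 2 * max 0 s) (at s)"
proof -
  consider "s < 0" | "s = 0" | "s > 0" by linarith
  then show ?thesis
  proof cases
    case 1
    have "((\<lambda>s::real. 0) has_real_derivative 2 * max 0 s) (at s)"
      using 1 by (auto intro!: derivative_eq_intros)
    then show ?thesis
      by (rule has_field_derivative_transform_within_open[where S="{..<0}"]) (use 1 in auto)
  next
    case 2
    have "((\<lambda>h::real. (max 0 h)\<^sup>2 / h) \<longlongrightarrow> 0) (at 0)"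
    proof (rule Lim_null_comparison)
      show "\<forall>\<^sub>F h::real in at 0. norm ((max 0 h)\<^sup>2 / h) \<le> \<bar>h\<bar>"
        by (intro always_eventually) (auto simp: max_def power2_eq_square)
      show "((\<lambda>h::real. \<bar>h\<bar>) \<longlongrightarrow> 0) (at 0)"
        by (auto intro!: tendsto_eq_intros)
    qed
    then show ?thesis using 2 by (simp add: DERIV_def)
  next
    case 3
    have "((\<lambda>s::real. s\<^sup>2) has_real_derivative 2 * max 0 s) (at s)"
      using 3 by (auto intro!: derivative_eq_intros)
    then show ?thesis
      by (rule has_field_derivative_transform_within_open[where S="{0<..}"]) (use 3 in auto)
  qed
qed

text \<open>The truncated factor survives in the derivative, so centres at distance at least \<rho>
  contribute nothing, and for the others the sign is decided by the inner product alone.\<close>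

lemma has_derivative_bump:
  fixes q :: "'a::real_inner"
  shows "((\<lambda>x. (max 0 (\<rho>\<^sup>2 - (norm (x - q))\<^sup>2))\<^sup>2) has_derivative
    (\<lambda>h. - 4 * max 0 (\<rho>\<^sup>2 - (norm (x - q))\<^sup>2) * ((x - q) \<bullet> h))) (at x)"
proof -
  have "((\<lambda>x. \<rho>\<^sup>2 - (norm (x - q))\<^sup>2) has_derivative (\<lambda>h. - 2 * ((x - q) \<bullet> h))) (at x)"
    unfolding power2_norm_eq_inner
    by (auto intro!: derivative_eq_intros simp: inner_commute)
  from has_derivative_compose[OF this DERIV_max_0_squared[unfolded has_field_derivative_def]]
  show ?thesis by (simp add: mult.assoc)
qed

text \<open>Here \<open>x\<close> lies in front of \<open>q\<close> with respect to the flow: drifting \<open>q\<close> by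
  \<open>\<tau> f x\<close> increases the distance to \<open>x\<close> only to second order in \<open>\<tau>\<close>, while the
  free choice of \<open>w\<close> decreases it to first order.\<close>

lemma closer_successor:
  fixes f :: "'a::real_inner \<Rightarrow> 'a"
  assumes x: "norm (x - q) < \<rho>" and front: "(x - q) \<bullet> f x \<ge> 0"
    and osc: "norm (f x - f q) \<le> \<eta> / 2" and M: "norm (f x) \<le> M"
    and pos: "\<eta> > 0" "\<tau> > 0" and small: "\<tau> * M\<^sup>2 \<le> \<rho> * \<eta> / 2" "\<tau> * \<eta> \<le> \<rho>"
  obtains w where "norm w \<le> \<eta>" "norm (x - (q + \<tau> *\<^sub>R (f q + w))) \<le> \<rho> - \<tau> * \<eta> / 4"
proof -
  define a where "a = x - q - \<tau> *\<^sub>R f x"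
  \<comment> \<open>Half of the budget \<eta> replaces the velocity \<open>f q\<close> by
    \<open>f x\<close>; the other half pulls along \<open>a\<close>, straight from the drifted
    centre towards \<open>x\<close>.\<close>
  define w where "w = f x - f q + (\<eta> / 2) *\<^sub>R sgn a"
  have \<rho>: "\<rho> > 0" using x norm_ge_zero[of "x - q"] by linarith
  have "(norm a)\<^sup>2 = (norm (x - q))\<^sup>2 - 2 * \<tau> * ((x - q) \<bullet> f x) + \<tau>\<^sup>2 * (norm (f x))\<^sup>2"
    unfolding a_def power2_norm_eq_inner
    by (simp add: inner_diff_left inner_diff_right inner_commute power2_eq_square algebra_simps)
  also have "\<dots> \<le> \<rho>\<^sup>2 - 0 + \<tau>\<^sup>2 * M\<^sup>2"
    using x front M pos by (intro add_mono diff_mono mult_left_mono power_mono) auto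
  also have "\<tau>\<^sup>2 * M\<^sup>2 \<le> \<tau> * (\<rho> * \<eta> / 2)"
    using mult_left_mono[OF small(1), of \<tau>] pos by (simp add: power2_eq_square mult.assoc)
  \<comment> \<open>Completing the square shows that drifting loses at most
    \<open>\<tau> * \<eta> / 4\<close>, which is half of what the pull wins back.\<close>
  also have "\<rho>\<^sup>2 - 0 + \<tau> * (\<rho> * \<eta> / 2) \<le> (\<rho> + \<tau> * \<eta> / 4)\<^sup>2"
    using pos by (simp add: power2_eq_square algebra_simps)
  finally have "(norm a)\<^sup>2 \<le> (\<rho> + \<tau> * \<eta> / 4)\<^sup>2" by simp
  then have a: "norm a \<le> \<rho> + \<tau> * \<eta> / 4"
    by (rule power2_le_imp_le) (use \<rho> pos in simp)
  have "norm w \<le> \<eta> / 2 + \<eta> / 2 * norm (sgn a)"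
    unfolding w_def using osc pos by (intro norm_triangle_mono) auto
  also have "\<dots> \<le> \<eta>" using pos by (simp add: norm_sgn)
  finally have w: "norm w \<le> \<eta>" .
  have "x - (q + \<tau> *\<^sub>R (f q + w)) = a - (\<tau> * \<eta> / 2) *\<^sub>R sgn a"
    by (simp add: w_def a_def algebra_simps)
  also have "norm \<dots> \<le> \<rho> - \<tau> * \<eta> / 4"
  proof (cases "a = 0")
    case True
    then show ?thesis using small pos \<rho> by simp
  next
    case False
    then have "norm a *\<^sub>R sgn a = a" by (simp add: sgn_div_norm)
    then have "a - (\<tau> * \<eta> / 2) *\<^sub>R sgn a = (norm a - \<tau> * \<eta> / 2) *\<^sub>R sgn a"
      by (simp add: scaleR_left_diff_distrib)
    \<comment> \<open>The pull may overshoot \<open>x\<close>. The distance is then at most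
      \<open>\<tau> * \<eta> / 2\<close>, and \<open>\<tau> * \<eta> \<le> \<rho>\<close> covers
      this case.\<close>
    then have "norm (a - (\<tau> * \<eta> / 2) *\<^sub>R sgn a) = \<bar>norm a - \<tau> * \<eta> / 2\<bar>"
      using False by (simp add: norm_sgn)
    moreover have "\<tau> * \<eta> > 0" using pos by simp
    ultimately show ?thesis using a small norm_ge_zero[of a] by linarith
  qed
  finally show thesis using that w by blast
qed

text \<open>This isolates the geometry from the differential equation: trajectories enter only
  through the invariance of \<open>S\<close> under steps of one fixed length \<tau>.\<close>

lemma barrier_certificate_from_invariant_set:
  fixes f :: "'a::euclidean_space \<Rightarrow> 'a"
  assumes "bounded S" "I \<subseteq> S"
    and inv: "\<And>q w. q \<in> S \<Longrightarrow> norm w \<le> \<eta> \<Longrightarrow> q + \<tau> *\<^sub>R (f q + w) \<in> S"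
    and osc: "\<And>q x. q \<in> S \<Longrightarrow> norm (x - q) < \<rho> \<Longrightarrow> norm (f x - f q) \<le> \<eta> / 2"
    and M: "\<And>q x. q \<in> S \<Longrightarrow> norm (x - q) < \<rho> \<Longrightarrow> norm (f x) \<le> M"
    and sep: "\<And>q x. q \<in> S \<Longrightarrow> norm (x - q) < \<rho> \<Longrightarrow> x \<notin> U"
    and pos: "\<eta> > 0" "\<tau> > 0" and small: "\<tau> * M\<^sup>2 \<le> \<rho> * \<eta> / 2" "\<tau> * \<eta> \<le> \<rho>"
  shows "\<exists>\<beta>. barrier_certificate f I U \<beta>"
proof -
  \<comment> \<open>A successor gains \<open>\<tau> * \<eta> / 4\<close>, that is
    \<open>2 * \<sigma>\<close>: one \<sigma> pays for rounding it to the net, the other is the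
    margin that makes \<beta> positive.\<close>
  define \<sigma> where "\<sigma> = \<tau> * \<eta> / 8"
  have \<sigma>: "\<sigma> > 0" "8 * \<sigma> \<le> \<rho>" using pos small by (auto simp: \<sigma>_def)
  have "compact (closure S)" using \<open>bounded S\<close> by (simp add: compact_closure)
  \<comment> \<open>Centres from \<open>S\<close> itself already cover the closure, so
    \<open>inv\<close> applies to every point of the net.\<close>
  moreover have "closure S \<subseteq> (\<Union>q\<in>S. ball q \<sigma>)"
    using \<sigma> by (fastforce simp: closure_approachable)
  ultimately obtain F where F: "finite F" "F \<subseteq> S" "closure S \<subseteq> (\<Union>q\<in>F. ball q \<sigma>)"
    using compactE_image[of "closure S" S "\<lambda>q. ball q \<sigma>"] by (metis open_ball)
  have net: "\<exists>p\<in>F. norm (q - p) < \<sigma>" if "q \<in> S" for q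
    using F(3) closure_subset that by (fastforce simp: dist_norm norm_minus_commute)
  define g where "g q x = max 0 (\<rho>\<^sup>2 - (norm (x - q))\<^sup>2)" for q x :: 'a
  \<comment> \<open>The height of a bump at distance \<open>\<rho> - \<sigma>\<close>: a single
    closer centre outweighs \<open>c\<close>.\<close>
  define c where "c = (\<rho>\<^sup>2 - (\<rho> - \<sigma>)\<^sup>2)\<^sup>2"
  define \<beta> where "\<beta> x = (\<Sum>q\<in>F. (g q x)\<^sup>2) - c" for x
  have level: "0 < \<rho>\<^sup>2 - (\<rho> - \<sigma>)\<^sup>2"
    using \<sigma> by (simp add: power2_eq_square algebra_simps)
  then have c: "c > 0" by (simp add: c_def)
  have \<beta>_pos: "\<beta> x > 0" if "p \<in> F" "norm (x - p) < \<rho> - \<sigma>" for x p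
  proof -
    have "(norm (x - p))\<^sup>2 < (\<rho> - \<sigma>)\<^sup>2"
      using that by (intro power_strict_mono) auto
    then have "c < (g p x)\<^sup>2"
      unfolding c_def g_def using level by (intro power_strict_mono) auto
    also have "\<dots> \<le> (\<Sum>q\<in>F. (g q x)\<^sup>2)"
      using F that by (intro member_le_sum) auto
    finally show ?thesis by (simp add: \<beta>_def)
  qed
  have active: "\<exists>q\<in>F. g q x > 0" if "\<beta> x \<ge> 0" for x
  proof (rule ccontr)
    assume "\<not> ?thesis"
    then have "\<forall>q\<in>F. g q x = 0" by (auto simp: g_def max_def)
    then show False using that c by (simp add: \<beta>_def)
  qed
  have near: "norm (x - q) < \<rho>" if "g q x > 0" for q x
  proof -
    have "(norm (x - q))\<^sup>2 < \<rho>\<^sup>2" using that by (auto simp: g_def)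
    then show ?thesis by (rule power2_less_imp_less) (use \<sigma> in simp)
  qed
  have deriv: "(\<beta> has_derivative (\<lambda>h. \<Sum>q\<in>F. - 4 * g q x * ((x - q) \<bullet> h))) (at x)" for x
  proof -
    have "((\<lambda>x. \<Sum>q\<in>F. (g q x)\<^sup>2) has_derivative
        (\<lambda>h. \<Sum>q\<in>F. - 4 * g q x * ((x - q) \<bullet> h))) (at x)"
      unfolding g_def by (rule has_derivative_sum) (rule has_derivative_bump)
    from has_derivative_diff[OF this has_derivative_const[of c]] show ?thesis
      by (simp only: \<beta>_def[abs_def] diff_zero)
  qed
  have "barrier_certificate f I U \<beta>"
    unfolding barrier_certificate_def
  proof (intro conjI allI ballI impI)
    show "\<beta> differentiable (at x)" for x
      using deriv by (auto simp: differentiable_def)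
  next
    fix x assume "x \<in> I"
    then obtain p where "p \<in> F" "norm (x - p) < \<sigma>" using net \<open>I \<subseteq> S\<close> by blast
    then show "\<beta> x \<ge> 0" using \<beta>_pos[of p x] \<sigma> by force
  next
    fix x assume "\<beta> x \<ge> 0"
    then show "x \<notin> U" using active near sep F by blast
  next
    fix x assume x: "\<beta> x = 0"
    \<comment> \<open>Otherwise a net point next to a successor of \<open>q\<close> is closer to
      \<open>x\<close> than \<open>\<rho> - \<sigma>\<close>, so \<beta> would be positive at
      \<open>x\<close>.\<close>
    have behind: "(x - q) \<bullet> f x < 0" if q: "q \<in> F" "g q x > 0" for q
    proof (rule ccontr)
      assume "\<not> ?thesis"
      then have front: "(x - q) \<bullet> f x \<ge> 0" by simp
      have "q \<in> S" and close: "norm (x - q) < \<rho>" using q F near by auto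
      obtain w where w: "norm w \<le> \<eta>"
        "norm (x - (q + \<tau> *\<^sub>R (f q + w))) \<le> \<rho> - \<tau> * \<eta> / 4"
        using closer_successor[where f=f and M=M, OF close front
            osc[OF \<open>q \<in> S\<close> close] M[OF \<open>q \<in> S\<close> close] pos small] .
      obtain p where "p \<in> F" "norm (q + \<tau> *\<^sub>R (f q + w) - p) < \<sigma>"
        using net inv[OF \<open>q \<in> S\<close> w(1)] by blast
      moreover have "norm (x - p) \<le> norm (x - (q + \<tau> *\<^sub>R (f q + w))) +
          norm (q + \<tau> *\<^sub>R (f q + w) - p)"
        by (metis add_diff_cancel_left diff_add_cancel diff_diff_eq2 norm_triangle_ineq)
      ultimately have "norm (x - p) < \<rho> - \<sigma>" using w(2) by (simp add: \<sigma>_def)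
      then show False using \<beta>_pos[of p x] \<open>p \<in> F\<close> x by simp
    qed
    obtain p where p: "p \<in> F" "g p x > 0" using active[of x] x by auto
    have g0: "g q x \<ge> 0" for q by (simp add: g_def)
    have "(\<Sum>q\<in>F. - 4 * g q x * ((x - q) \<bullet> f x)) > 0"
    proof (rule sum_pos2[OF F(1) p(1)])
      show "0 < - 4 * g p x * ((x - p) \<bullet> f x)"
        using behind[OF p] p by (simp add: mult_less_0_iff mult_pos_neg)
      show "0 \<le> - 4 * g q x * ((x - q) \<bullet> f x)" if "q \<in> F" for q
        using behind[OF that] g0[of q] by (cases "g q x = 0") (auto simp: mult_le_0_iff)
    qed
    then show "frechet_derivative \<beta> (at x) (f x) > 0"
      using frechet_derivative_at[OF deriv, of x] by metis
  qed
  then show ?thesis by blast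
qed

section \<open>Differentiable concatenation of curves\<close>

definition concat_at :: "real \<Rightarrow> (real \<Rightarrow> 'a) \<Rightarrow> (real \<Rightarrow> 'a) \<Rightarrow> real \<Rightarrow> 'a" where
  "concat_at T y z t = (if t \<le> T then y t else z (t - T))"

lemma concat_at_has_vector_derivative_left:
  assumes "(y has_vector_derivative d) (at t within {0..})" "0 \<le> t" "t < T"
  shows "(concat_at T y z has_vector_derivative d) (at t within {0..})"
  using assms
  by (intro has_vector_derivative_transform_within[OF assms(1), of "T - t"])
    (auto simp: concat_at_def dist_real_def)

lemma has_vector_derivative_shift:
  fixes z :: "real \<Rightarrow> 'a::real_normed_vector"
  assumes "(z has_vector_derivative d) (at (t - T) within {0..})"
  shows "((\<lambda>s. z (s - T)) has_vector_derivative d) (at t within {T..})"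
proof -
  have "((\<lambda>s. s - T) has_vector_derivative 1) (at t within {T..})"
    by (auto intro!: derivative_eq_intros)
  moreover have "(\<lambda>s. s - T) ` {T..} \<subseteq> {0..}" by auto
  then have "(z has_vector_derivative d) (at (t - T) within (\<lambda>s. s - T) ` {T..})"
    using assms by (rule has_vector_derivative_within_subset[rotated])
  ultimately show ?thesis
    using vector_diff_chain_within[of "\<lambda>s. s - T" 1 t "{T..}" z d] by (simp add: o_def)
qed

lemma concat_at_has_vector_derivative_right:
  fixes z :: "real \<Rightarrow> 'a::real_normed_vector"
  assumes z: "(z has_vector_derivative d) (at (t - T) within {0..})" and "0 \<le> T" "T < t"
  shows "(concat_at T y z has_vector_derivative d) (at t within {0..})"
proof -
  have "at t within {T..} = at t within {0..}"
    using assms by (intro at_within_nhd[where S="{T<..}"]) auto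
  then have "((\<lambda>s. z (s - T)) has_vector_derivative d) (at t within {0..})"
    using has_vector_derivative_shift[OF z] by simp
  then show ?thesis
    using assms
    by (elim has_vector_derivative_transform_within[where d="t - T"])
      (auto simp: concat_at_def dist_real_def)
qed

text \<open>An \<open>eps_solution\<close> needs a derivative at every time, so velocities must
  agree at the seam. This is why arrival velocities are tracked below.\<close>

lemma concat_at_has_vector_derivative_mid:
  fixes y z :: "real \<Rightarrow> 'a::real_normed_vector"
  assumes y: "(y has_vector_derivative d) (at T within {0..})"
    and z: "(z has_vector_derivative d) (at 0 within {0..})"
    and "0 \<le> T" "y T = z 0"
  shows "(concat_at T y z has_vector_derivative d) (at T within {0..})"
proof -
  have cl: "closure {0..T} \<inter> closure {T..} = {T}" using \<open>0 \<le> T\<close> by auto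
  have "((\<lambda>t. if t \<in> {0..T} then y t else z (t - T)) has_vector_derivative
      (if T \<in> {0..T} then d else d)) (at T within {0..})"
  proof (rule has_vector_derivative_If_within_closures[where T="{T..}"], unfold cl)
    show "(y has_vector_derivative d) (at T within {0..T} \<union> {T})"
      using \<open>0 \<le> T\<close> by (intro has_vector_derivative_within_subset[OF y]) auto
    show "((\<lambda>t. z (t - T)) has_vector_derivative d) (at T within {T..} \<union> {T})"
      using has_vector_derivative_shift[of z d T T] z by (simp add: insert_absorb)
  qed (use assms in auto)
  then show ?thesis
    using \<open>0 \<le> T\<close>
    by (auto intro: has_vector_derivative_transform[rotated 2] simp: concat_at_def)
qed

text \<open>The first curve is constrained only up to time \<open>T\<close>, so a finite arc can be
  used whatever its formula gives later.\<close>

lemma eps_solution_concat_at: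
  assumes y: "\<And>t. 0 \<le> t \<Longrightarrow> t < T \<Longrightarrow> \<exists>y'. (y has_vector_derivative y') (at t within {0..})
      \<and> norm (f (y t) - y') \<le> \<epsilon>"
    and yT: "(y has_vector_derivative d) (at T within {0..})"
    and z: "eps_solution f \<epsilon> z" and z0: "(z has_vector_derivative d) (at 0 within {0..})"
    and d: "norm (f (y T) - d) \<le> \<epsilon>"
    and T: "0 \<le> T" "y T = z 0"
  shows "eps_solution f \<epsilon> (concat_at T y z)"
  unfolding eps_solution_def
proof (intro allI impI)
  fix t :: real assume "t \<ge> 0"
  consider "t < T" | "t = T" | "t > T" by linarith
  then show "\<exists>x'. (concat_at T y z has_vector_derivative x') (at t within {0..})
      \<and> norm (f (concat_at T y z t) - x') \<le> \<epsilon>"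
  proof cases
    case 1
    with y[of t] \<open>t \<ge> 0\<close> obtain y' where
      "(y has_vector_derivative y') (at t within {0..})" "norm (f (y t) - y') \<le> \<epsilon>" by auto
    with 1 \<open>t \<ge> 0\<close> show ?thesis
      by (auto intro!: exI[of _ y'] concat_at_has_vector_derivative_left simp: concat_at_def)
  next
    case 2
    with concat_at_has_vector_derivative_mid[OF yT z0 T] d show ?thesis
      by (auto simp: concat_at_def)
  next
    case 3
    then have "t - T \<ge> 0" by simp
    with z obtain z' where "(z has_vector_derivative z') (at (t - T) within {0..})"
        "norm (f (z (t - T)) - z') \<le> \<epsilon>"
      unfolding eps_solution_def by blast
    with 3 T show ?thesis
      by (auto intro!: exI[of _ z'] concat_at_has_vector_derivative_right simp: concat_at_def)
  qed
qed

section \<open>States reached with the velocity of the flow\<close>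

text \<open>Every \<open>eps_solution\<close> lives on the whole half-line; the flow supplies the
  tail after a finite arc.\<close>

lemma global_flow_solution:
  assumes "global_flow f" "\<epsilon> \<ge> 0"
  obtains z where "eps_solution f \<epsilon> z" "z 0 = q"
    "(z has_vector_derivative f q) (at 0 within {0..})"
proof -
  obtain \<phi> where \<phi>: "\<And>x. \<phi> x 0 = x"
      "\<And>x t. (\<phi> x has_vector_derivative f (\<phi> x t)) (at t)"
    using assms unfolding global_flow_def by metis
  show thesis
  proof
    show "eps_solution f \<epsilon> (\<phi> q)"
      unfolding eps_solution_def
      using has_vector_derivative_at_within[OF \<phi>(2)] \<open>\<epsilon> \<ge> 0\<close>
      by (metis cancel_comm_monoid_add_class.diff_cancel norm_zero)
    show "(\<phi> q has_vector_derivative f q) (at 0 within {0..})"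
      using \<phi>(2)[of q 0] \<phi>(1) by (simp add: has_vector_derivative_at_within)
  qed (rule \<phi>)
qed

text \<open>Reachability by a solution whose velocity on arrival is that of the flow, so that
  further pieces can be attached differentiably.\<close>

definition tangent_reach ::
    "('a::real_normed_vector \<Rightarrow> 'a) \<Rightarrow> real \<Rightarrow> 'a set \<Rightarrow> 'a set" where
  "tangent_reach f \<epsilon> X = {y T | y T. 0 \<le> T \<and> eps_solution f \<epsilon> y \<and> y 0 \<in> X \<and>
     (y has_vector_derivative f (y T)) (at T within {0..})}"

lemma subset_tangent_reach:
  assumes "global_flow f" "\<epsilon> \<ge> 0"
  shows "X \<subseteq> tangent_reach f \<epsilon> X"
proof
  fix q assume "q \<in> X"
  obtain z where "eps_solution f \<epsilon> z" "z 0 = q"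
    "(z has_vector_derivative f q) (at 0 within {0..})"
    using global_flow_solution[OF assms] .
  then show "q \<in> tangent_reach f \<epsilon> X"
    unfolding tangent_reach_def using \<open>q \<in> X\<close> by (auto intro!: exI[of _ z] exI[of _ 0])
qed

text \<open>The step is realised by the cubic Hermite curve whose end velocities are those of the
  flow.\<close>

lemma tangent_reach_step:
  assumes flow: "global_flow f" and q: "q \<in> tangent_reach f \<epsilon> X" and "\<epsilon> > 0"
    and osc: "\<And>x. norm (x - q) \<le> \<delta> \<Longrightarrow> norm (f x - f q) \<le> \<epsilon> / 8"
    and \<tau>: "\<tau> > 0" "\<tau> * (norm (f q) + \<epsilon>) \<le> \<delta>" and w: "norm w \<le> \<epsilon> / 2"
  shows "q + \<tau> *\<^sub>R (f q + w) \<in> tangent_reach f \<epsilon> X"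
proof -
  obtain y T where y: "y T = q" "0 \<le> T" "eps_solution f \<epsilon> y" "y 0 \<in> X"
      "(y has_vector_derivative f q) (at T within {0..})"
    using q unfolding tangent_reach_def by blast
  define p where "p = q + \<tau> *\<^sub>R (f q + w)"
  have "norm (p - q) = \<tau> * norm (f q + w)" using \<tau> by (simp add: p_def)
  also have "\<dots> \<le> \<tau> * (norm (f q) + \<epsilon>)"
    using \<tau> w \<open>\<epsilon> > 0\<close> by (intro mult_left_mono norm_triangle_mono) auto
  finally have fp: "norm (f p - f q) \<le> \<epsilon> / 8" using osc \<tau> by simp
  obtain z where z: "eps_solution f \<epsilon> z" "z 0 = p"
    "(z has_vector_derivative f p) (at 0 within {0..})"
    using global_flow_solution[OF flow] \<open>\<epsilon> > 0\<close> by (metis less_imp_le)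
  \<comment> \<open>The coefficient of \<open>w\<close> produces the displacement
    \<open>\<tau> *\<^sub>R w\<close> with zero velocity at both ends. That of
    \<open>f p - f q\<close> vanishes at both ends and only turns the final velocity into
    \<open>f p\<close>.\<close>
  define c where "c t = q + t *\<^sub>R f q + (\<tau> * (3 * (t / \<tau>)\<^sup>2 - 2 * (t / \<tau>) ^ 3)) *\<^sub>R w
      + (\<tau> * ((t / \<tau>) ^ 3 - (t / \<tau>)\<^sup>2)) *\<^sub>R (f p - f q)" for t
  define c' where "c' t = f q + (6 * (t / \<tau>) - 6 * (t / \<tau>)\<^sup>2) *\<^sub>R w
      + (3 * (t / \<tau>)\<^sup>2 - 2 * (t / \<tau>)) *\<^sub>R (f p - f q)" for t
  have c_deriv: "(c has_vector_derivative c' t) (at t within {0..})" for t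
  proof -
    have "((\<lambda>t. \<tau> * (3 * (t * k)\<^sup>2 - 2 * (t * k) ^ 3)) has_real_derivative
        \<tau> * k * (6 * (t * k) - 6 * (t * k)\<^sup>2)) (at t within {0..})" for k
      by (auto intro!: derivative_eq_intros simp: algebra_simps power2_eq_square power3_eq_cube)
    from this[of "1 / \<tau>"] have a: "((\<lambda>t. \<tau> * (3 * (t / \<tau>)\<^sup>2 - 2 * (t / \<tau>) ^ 3)) has_real_derivative
        6 * (t / \<tau>) - 6 * (t / \<tau>)\<^sup>2) (at t within {0..})"
      using \<tau> by simp
    have "((\<lambda>t. \<tau> * ((t * k) ^ 3 - (t * k)\<^sup>2)) has_real_derivative
        \<tau> * k * (3 * (t * k)\<^sup>2 - 2 * (t * k))) (at t within {0..})" for k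
      by (auto intro!: derivative_eq_intros simp: algebra_simps power2_eq_square power3_eq_cube)
    from this[of "1 / \<tau>"] have b: "((\<lambda>t. \<tau> * ((t / \<tau>) ^ 3 - (t / \<tau>)\<^sup>2)) has_real_derivative
        3 * (t / \<tau>)\<^sup>2 - 2 * (t / \<tau>)) (at t within {0..})"
      using \<tau> by simp
    have l: "((\<lambda>t. q + t *\<^sub>R f q) has_vector_derivative f q) (at t within {0..})"
      by (auto intro!: derivative_eq_intros)
    show ?thesis
      unfolding c_def c'_def
      using has_vector_derivative_add[OF has_vector_derivative_add[OF l
          has_vector_derivative_scaleR[OF a has_vector_derivative_const]]
          has_vector_derivative_scaleR[OF b has_vector_derivative_const]]
      by simp
  qed
  have c0: "c 0 = q" "c' 0 = f q" and c\<tau>: "c \<tau> = p" "c' \<tau> = f p"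
    using \<tau> by (simp_all add: c_def c'_def p_def algebra_simps)
  have c_eps: "norm (f (c t) - c' t) \<le> \<epsilon>" if t: "0 \<le> t" "t < \<tau>" for t
  proof -
    define \<theta> where "\<theta> = t / \<tau>"
    have \<theta>: "0 \<le> \<theta>" "\<theta> \<le> 1" "t = \<tau> * \<theta>" using t \<tau> by (auto simp: \<theta>_def)
    have \<theta>2: "0 \<le> \<theta>\<^sup>2" "\<theta>\<^sup>2 \<le> \<theta>" "\<theta> ^ 3 \<le> \<theta>\<^sup>2" "0 \<le> \<theta> ^ 3"
      using \<theta> by (auto simp: power2_eq_square power3_eq_cube mult_left_le mult_left_le_one_le)
    \<comment> \<open>These yield, in turn, the bounds on
      \<open>6 * \<theta> - 6 * \<theta>\<^sup>2\<close> from above, on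
      \<open>3 * \<theta>\<^sup>2 - 2 * \<theta>\<close> from below, and on
      \<open>3 * \<theta>\<^sup>2 - 2 * \<theta> ^ 3\<close> from above.\<close>
    have sq: "(\<theta> - 1 / 2)\<^sup>2 \<ge> 0" "(\<theta> - 1 / 3)\<^sup>2 \<ge> 0" "(1 - \<theta>)\<^sup>2 * (1 + 2 * \<theta>) \<ge> 0"
      using \<theta> by simp_all
    \<comment> \<open>The arc stays in the ball of radius \<delta> around \<open>q\<close>, where
      \<open>osc\<close> controls \<open>f\<close>.\<close>
    have "norm (c t - q) \<le> norm (t *\<^sub>R f q) + norm ((\<tau> * (3 * \<theta>\<^sup>2 - 2 * \<theta> ^ 3)) *\<^sub>R w)
        + norm ((\<tau> * (\<theta> ^ 3 - \<theta>\<^sup>2)) *\<^sub>R (f p - f q))"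
      unfolding c_def \<theta>_def by (simp add: norm_triangle_mono)
    also have "\<dots> \<le> \<tau> * norm (f q) + \<tau> * (\<epsilon> / 2) + \<tau> * (\<epsilon> / 8)"
    proof (intro add_mono)
      show "norm (t *\<^sub>R f q) \<le> \<tau> * norm (f q)" using t by (simp add: mult_right_mono)
      have "\<bar>3 * \<theta>\<^sup>2 - 2 * \<theta> ^ 3\<bar> \<le> 1"
        using sq(3) \<theta>2 by (simp add: abs_le_iff power2_eq_square power3_eq_cube algebra_simps)
      then have "\<tau> * \<bar>3 * \<theta>\<^sup>2 - 2 * \<theta> ^ 3\<bar> * norm w \<le> \<tau> * 1 * (\<epsilon> / 2)"
        using \<tau> w by (intro mult_mono mult_left_mono) auto
      then show "norm ((\<tau> * (3 * \<theta>\<^sup>2 - 2 * \<theta> ^ 3)) *\<^sub>R w) \<le> \<tau> * (\<epsilon> / 2)"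
        using \<tau> by (simp add: abs_mult)
      have "\<bar>\<theta> ^ 3 - \<theta>\<^sup>2\<bar> \<le> 1" using \<theta> \<theta>2 by linarith
      then have "\<tau> * \<bar>\<theta> ^ 3 - \<theta>\<^sup>2\<bar> * norm (f p - f q) \<le> \<tau> * 1 * (\<epsilon> / 8)"
        using \<tau> fp by (intro mult_mono mult_left_mono) auto
      then show "norm ((\<tau> * (\<theta> ^ 3 - \<theta>\<^sup>2)) *\<^sub>R (f p - f q)) \<le> \<tau> * (\<epsilon> / 8)"
        using \<tau> by (simp add: abs_mult)
    qed
    also have "\<dots> \<le> \<tau> * (norm (f q) + \<epsilon>)" using \<tau> \<open>\<epsilon> > 0\<close> by (simp add: algebra_simps)
    finally have fc: "norm (f (c t) - f q) \<le> \<epsilon> / 8" using osc \<tau> by simp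
    have "f (c t) - c' t = (f (c t) - f q) - (6 * \<theta> - 6 * \<theta>\<^sup>2) *\<^sub>R w
        - (3 * \<theta>\<^sup>2 - 2 * \<theta>) *\<^sub>R (f p - f q)"
      by (simp add: c'_def \<theta>_def algebra_simps)
    also have "norm \<dots> \<le> norm (f (c t) - f q) + \<bar>6 * \<theta> - 6 * \<theta>\<^sup>2\<bar> * norm w
        + \<bar>3 * \<theta>\<^sup>2 - 2 * \<theta>\<bar> * norm (f p - f q)"
      using norm_triangle_ineq4[of "f (c t) - f q - (6 * \<theta> - 6 * \<theta>\<^sup>2) *\<^sub>R w"
          "(3 * \<theta>\<^sup>2 - 2 * \<theta>) *\<^sub>R (f p - f q)"]
        norm_triangle_ineq4[of "f (c t) - f q" "(6 * \<theta> - 6 * \<theta>\<^sup>2) *\<^sub>R w"]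
      unfolding norm_scaleR by linarith
    \<comment> \<open>The three terms add up to exactly \<epsilon>. The peak 3/2 of the velocity
      profile is what limits \<open>w\<close> to \<open>\<epsilon> / 2\<close>.\<close>
    also have "\<dots> \<le> \<epsilon> / 8 + 3 / 2 * (\<epsilon> / 2) + 1 * (\<epsilon> / 8)"
    proof (intro add_mono mult_mono fc w fp)
      show "\<bar>6 * \<theta> - 6 * \<theta>\<^sup>2\<bar> \<le> 3 / 2"
        using sq(1) \<theta>2 by (simp add: abs_le_iff power2_eq_square algebra_simps)
      show "\<bar>3 * \<theta>\<^sup>2 - 2 * \<theta>\<bar> \<le> 1"
        using sq(2) \<theta>2 \<theta> by (simp add: abs_le_iff power2_eq_square algebra_simps)
    qed auto
    finally show ?thesis using \<open>\<epsilon> > 0\<close> by simp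
  qed
  have arc: "eps_solution f \<epsilon> (concat_at \<tau> c z)"
    using c_deriv[of \<tau>] c_deriv c_eps z \<tau> c\<tau> \<open>\<epsilon> > 0\<close>
    by (intro eps_solution_concat_at[where d="f p"]) auto
  have arc0: "(concat_at \<tau> c z has_vector_derivative f q) (at 0 within {0..})"
    using c_deriv[of 0] c0 \<tau> by (intro concat_at_has_vector_derivative_left) auto
  have arc\<tau>: "(concat_at \<tau> c z has_vector_derivative f p) (at \<tau> within {0..})"
    using c_deriv[of \<tau>] c\<tau> \<tau> z by (intro concat_at_has_vector_derivative_mid) auto
  \<comment> \<open>Both seams match: \<open>y\<close> arrives at \<open>q\<close> with velocity
    \<open>f q\<close>, and the cubic arc hands over to the flow at \<open>p\<close> with velocity
    \<open>f p\<close>.\<close>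
  define x where "x = concat_at T y (concat_at \<tau> c z)"
  have "eps_solution f \<epsilon> x"
    unfolding x_def
  proof (rule eps_solution_concat_at[OF _ _ arc arc0])
    show "\<exists>y'. (y has_vector_derivative y') (at t within {0..}) \<and> norm (f (y t) - y') \<le> \<epsilon>"
      if "0 \<le> t" for t
      using y(3) that unfolding eps_solution_def by blast
  qed (use y c0 \<tau> \<open>\<epsilon> > 0\<close> in \<open>simp_all add: concat_at_def\<close>)
  moreover have "x 0 \<in> X" "x (T + \<tau>) = p"
    using y \<tau> c\<tau> by (auto simp: x_def concat_at_def)
  moreover have "(x has_vector_derivative f p) (at (T + \<tau>) within {0..})"
    unfolding x_def
    by (rule concat_at_has_vector_derivative_right) (use arc\<tau> y \<tau> in simp_all)
  ultimately show ?thesis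
    unfolding tangent_reach_def using y \<tau> p_def
    by (auto intro!: exI[of _ x] exI[of _ "T + \<tau>"])
qed

section \<open>Perturbation and displacement of solutions\<close>

text \<open>Adding a multiple of \<open>t / (1 + t)\<close> keeps the start and stays bounded, with
  bounded derivative, for all times; a drift linear in \<open>t\<close> would eventually leave the
  region where \<open>osc\<close> holds. Hitting \<open>y T + u\<close> costs a factor
  \<open>(1 + T) / T\<close>, hence the lower bound on \<open>T\<close>.\<close>

lemma eps_solution_perturb:
  assumes y: "eps_solution f (\<epsilon> / 2) y" "y 0 \<in> X" and T: "0 < \<tau>" "\<tau> \<le> T"
    and osc: "\<And>t x. 0 \<le> t \<Longrightarrow> norm (x - y t) \<le> \<delta> \<Longrightarrow> norm (f x - f (y t)) \<le> \<epsilon> / 8"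
    and u: "norm u * (1 + 1 / \<tau>) \<le> \<delta>" "norm u * (1 + 1 / \<tau>) \<le> \<epsilon> / 4"
    and "\<epsilon> > 0"
  shows "y T + u \<in> reach f \<epsilon> {0..} X"
proof -
  define v where "v = ((1 + T) / T) *\<^sub>R u"
  have "(1 + T) / T \<le> 1 + 1 / \<tau>" using T by (simp add: field_simps)
  then have "norm v \<le> (1 + 1 / \<tau>) * norm u"
    using T mult_right_mono[of "(1 + T) / T" "1 + 1 / \<tau>" "norm u"] by (simp add: v_def)
  then have v: "norm v \<le> \<delta>" "norm v \<le> \<epsilon> / 4" using u by (auto simp: mult.commute)
  define x where "x t = y t + (t / (1 + t)) *\<^sub>R v" for t
  have "eps_solution f \<epsilon> x"
    unfolding eps_solution_def
  proof (intro allI impI)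
    fix t :: real assume t: "t \<ge> 0"
    with y obtain y' where y': "(y has_vector_derivative y') (at t within {0..})"
        "norm (f (y t) - y') \<le> \<epsilon> / 2"
      unfolding eps_solution_def by blast
    have "(x has_vector_derivative y' + (1 / (1 + t)\<^sup>2) *\<^sub>R v) (at t within {0..})"
      unfolding x_def using t y'(1)
      by (auto intro!: derivative_eq_intros simp: field_simps power2_eq_square)
    moreover have "norm (f (x t) - (y' + (1 / (1 + t)\<^sup>2) *\<^sub>R v)) \<le> \<epsilon>"
    proof -
      have "norm (x t - y t) = t / (1 + t) * norm v" using t by (simp add: x_def)
      also have "\<dots> \<le> 1 * norm v" using t by (intro mult_right_mono) auto
      finally have 1: "norm (f (x t) - f (y t)) \<le> \<epsilon> / 8" using osc t v by simp
      have "norm ((1 / (1 + t)\<^sup>2) *\<^sub>R v) = 1 / (1 + t)\<^sup>2 * norm v" by simp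
      also have "\<dots> \<le> 1 * norm v" using t by (intro mult_right_mono) auto
      finally have 2: "norm ((1 / (1 + t)\<^sup>2) *\<^sub>R v) \<le> \<epsilon> / 4" using v by linarith
      have "f (x t) - (y' + (1 / (1 + t)\<^sup>2) *\<^sub>R v) =
          (f (x t) - f (y t)) + (f (y t) - y') - (1 / (1 + t)\<^sup>2) *\<^sub>R v" by simp
      also have "norm \<dots> \<le> norm (f (x t) - f (y t)) + norm (f (y t) - y')
          + norm ((1 / (1 + t)\<^sup>2) *\<^sub>R v)"
        by (meson add_mono norm_triangle_ineq norm_triangle_ineq4 order_refl order_trans)
      finally show ?thesis using 1 2 y' \<open>\<epsilon> > 0\<close> by linarith
    qed
    ultimately show "\<exists>x'. (x has_vector_derivative x') (at t within {0..})
        \<and> norm (f (x t) - x') \<le> \<epsilon>" by blast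
  qed
  moreover have "x 0 \<in> X" using y by (simp add: x_def)
  moreover have "x T = y T + u" using T by (simp add: x_def v_def)
  ultimately show ?thesis
    unfolding reach_def using T by (intro CollectI exI[of _ x] exI[of _ T]) auto
qed

text \<open>The mean value inequality with speed at most \<open>M + \<epsilon>\<close>; it serves
  the arrival times too short for \<open>eps_solution_perturb\<close>.\<close>

lemma eps_solution_displacement:
  assumes y: "eps_solution f \<epsilon> y" and "0 \<le> T"
    and M: "\<And>t. 0 \<le> t \<Longrightarrow> norm (f (y t)) \<le> M"
  shows "norm (y T - y 0) \<le> (M + \<epsilon>) * T"
proof -
  obtain y' where y': "\<And>t. 0 \<le> t \<Longrightarrow> (y has_vector_derivative y' t) (at t within {0..})"
      "\<And>t. 0 \<le> t \<Longrightarrow> norm (f (y t) - y' t) \<le> \<epsilon>"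
    using y unfolding eps_solution_def by metis
  have "norm (y T - y 0) \<le> (M + \<epsilon>) * norm (T - 0)"
  proof (rule differentiable_bound[where S="{0..T}" and f'="\<lambda>t h. h *\<^sub>R y' t"])
    fix t assume t: "t \<in> {0..T}"
    show "(y has_derivative (\<lambda>h. h *\<^sub>R y' t)) (at t within {0..T})"
      using t y'(1)[of t] unfolding has_vector_derivative_def
      by (auto intro: has_derivative_subset)
    have "norm (y' t) \<le> norm (f (y t)) + norm (f (y t) - y' t)"
      by (metis norm_minus_commute norm_triangle_sub)
    then have "norm (y' t) \<le> M + \<epsilon>" using M[of t] y'(2)[of t] t by simp
    then show "onorm (\<lambda>h. h *\<^sub>R y' t) \<le> M + \<epsilon>"
      by (intro onorm_le) (simp add: mult.commute[of "M + \<epsilon>"] mult_left_mono)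
  qed (use \<open>0 \<le> T\<close> in auto)
  then show ?thesis using \<open>0 \<le> T\<close> by simp
qed

section \<open>Choice of the constants for a robustly safe problem\<close>

lemma smooth_imp_continuous_on:
  fixes f :: "'a::real_normed_vector \<Rightarrow> 'b::real_normed_vector"
  shows "smooth f \<Longrightarrow> continuous_on UNIV f"
proof -
  assume "smooth f"
  then obtain D :: "nat \<Rightarrow> 'a \<Rightarrow> 'a list \<Rightarrow> 'b" where
    "\<And>x. D 0 x [] = f x" "\<And>k vs. length vs = k \<Longrightarrow> continuous_on UNIV (\<lambda>x. D k x vs)"
    unfolding smooth_def by blast
  from this(2)[of "[]" 0] this(1) show ?thesis by simp
qed

theorem theorem1:
  fixes f :: "real ^ 'n \<Rightarrow> real ^ 'n" and I U :: "(real ^ 'n) set"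
  assumes "smooth f"
    and "global_flow f"
    and "robustly_safe f I U"
    and "closure I \<inter> closure U = {}"
    and "bounded (UNIV - U)"
  shows "\<exists>\<beta>. barrier_certificate f I U \<beta>"
proof -
  obtain \<epsilon> where \<epsilon>: "\<epsilon> > 0" "reach f \<epsilon> {0..} I \<inter> U = {}"
    using assms(3) unfolding robustly_safe_def by blast
  obtain B where B: "\<And>x. x \<notin> U \<Longrightarrow> norm x \<le> B"
    using assms(5) unfolding bounded_iff by auto
  \<comment> \<open>The extra unit of radius leaves room for \<delta>-neighbourhoods of safe states,
    as \<delta> will be at most 1.\<close>
  let ?K = "cball 0 (B + 1) :: (real ^ 'n) set"
  have cont: "continuous_on ?K f"
    using smooth_imp_continuous_on[OF assms(1)] continuous_on_subset by blast
  then have "bounded (f ` ?K)" by (intro compact_imp_bounded compact_continuous_image) auto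
  then obtain M where "M > 0" and MK: "\<And>x. x \<in> ?K \<Longrightarrow> norm (f x) \<le> M"
    unfolding bounded_pos by auto
  have "uniformly_continuous_on ?K f" using cont by (simp add: compact_uniformly_continuous)
  \<comment> \<open>\<open>tangent_reach_step\<close> will be used with tolerance
    \<open>\<epsilon> / 2\<close> and asks for an eighth of it.\<close>
  moreover have "\<epsilon> / 16 > 0" using \<epsilon> by simp
  ultimately obtain \<delta>0 where \<delta>0: "\<delta>0 > 0" "\<And>x y. x \<in> ?K \<Longrightarrow> y \<in> ?K \<Longrightarrow>
      dist y x < \<delta>0 \<Longrightarrow> dist (f y) (f x) < \<epsilon> / 16"
    unfolding uniformly_continuous_on_def by meson
  define \<delta> where "\<delta> = min (\<delta>0 / 2) 1"
  have \<delta>: "\<delta> > 0" "\<delta> \<le> 1" "\<delta> < \<delta>0" using \<delta>0(1) by (auto simp: \<delta>_def min_def)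
  have nearK: "x \<in> ?K" if "q \<notin> U" "norm (x - q) \<le> \<delta>" for q x
    using B[OF that(1)] that(2) \<delta> norm_triangle_ineq2[of x q] by simp
  have osc: "norm (f x - f q) \<le> \<epsilon> / 16" if "q \<notin> U" "norm (x - q) \<le> \<delta>" for q x
    using \<delta>0(2)[OF nearK[of q q] nearK[OF that]] that \<delta> by (simp add: dist_norm)
  have M: "norm (f x) \<le> M" if "q \<notin> U" "norm (x - q) \<le> \<delta>" for q x
    using MK nearK that by blast

  \<comment> \<open>Only half of the robustness margin is spent here; the rest pays for the
    perturbation that separates \<open>S\<close> from \<open>U\<close>.\<close>
  define S where "S = tangent_reach f (\<epsilon> / 2) I"
  have safe: "y t \<notin> U" if "eps_solution f (\<epsilon> / 2) y" "y 0 \<in> I" "0 \<le> t" for y t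
  proof -
    have "eps_solution f \<epsilon> y"
      using that(1) \<epsilon>(1) unfolding eps_solution_def by fastforce
    then show ?thesis using that \<epsilon>(2) unfolding reach_def by auto
  qed
  have S_safe: "q \<notin> U" if "q \<in> S" for q
    using that safe unfolding S_def tangent_reach_def by auto
  have "I \<subseteq> S" using subset_tangent_reach[OF assms(2)] \<epsilon> by (simp add: S_def)
  then have "bounded S" "bounded I" using B S_safe unfolding bounded_iff by blast+
  then have "compact (closure I)" by (simp add: compact_closure)
  then obtain e where e: "e > 0" "\<And>x y. x \<in> closure I \<Longrightarrow> y \<in> closure U \<Longrightarrow> e \<le> dist x y"
    using separate_compact_closed[of "closure I" "closure U"] assms(4) by auto
  \<comment> \<open>Up to this time a solution moves at most \<open>e / 2\<close> away from its
    start.\<close>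
  define t\<^sub>0 where "t\<^sub>0 = e / (2 * (M + \<epsilon>))"
  have "M + \<epsilon> > 0" using \<open>M > 0\<close> \<epsilon> by simp
  then have t0: "t\<^sub>0 > 0" "(M + \<epsilon>) * t\<^sub>0 = e / 2"
    using e(1) by (simp_all only: t\<^sub>0_def) (simp_all add: field_simps)
  \<comment> \<open>The entry \<open>e / 2\<close> serves short arrival times; the last two make any
    offset shorter than \<rho> admissible in \<open>eps_solution_perturb\<close> from time
    \<open>t\<^sub>0\<close> on.\<close>
  define \<rho> where "\<rho> = Min {\<delta>, e / 2, \<delta> / (1 + 1 / t\<^sub>0), \<epsilon> / 4 / (1 + 1 / t\<^sub>0)}"
  have t0': "1 + 1 / t\<^sub>0 > 0" using t0 by (simp add: add_pos_pos)
  have \<rho>: "\<rho> > 0" "\<rho> \<le> \<delta>" "\<rho> \<le> e / 2"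
    "\<rho> \<le> \<delta> / (1 + 1 / t\<^sub>0)" "\<rho> \<le> \<epsilon> / 4 / (1 + 1 / t\<^sub>0)"
  proof -
    show "\<rho> > 0" unfolding \<rho>_def using \<delta>(1) e(1) \<epsilon>(1) t0' by simp
  qed (unfold \<rho>_def, (rule Min_le; simp)+)
  have sep: "x \<notin> U" if "q \<in> S" "norm (x - q) < \<rho>" for x q
  proof -
    obtain y T where y: "q = y T" "0 \<le> T" "eps_solution f (\<epsilon> / 2) y" "y 0 \<in> I"
      using \<open>q \<in> S\<close> unfolding S_def tangent_reach_def by blast
    show ?thesis
    proof (cases "T \<le> t\<^sub>0")
      case True
      have "norm (f (y t)) \<le> M" if "0 \<le> t" for t
        using M[OF safe[OF y(3,4) that], of "y t"] \<delta> by simp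
      then have "norm (y T - y 0) \<le> (M + \<epsilon> / 2) * T"
        by (rule eps_solution_displacement[OF y(3,2)])
      also have "\<dots> \<le> (M + \<epsilon>) * t\<^sub>0" using True y \<open>M > 0\<close> \<epsilon> by (intro mult_mono) auto
      finally have "norm (q - y 0) \<le> e / 2" using t0 y by simp
      then have "dist (y 0) x < e"
        using that(2) \<rho> norm_triangle_ineq[of "x - q" "q - y 0"]
        by (simp add: dist_norm norm_minus_commute)
      then show ?thesis using e(2)[of "y 0" x] y closure_subset by force
    next
      \<comment> \<open>Here \<open>x\<close> itself is the endpoint of an \<epsilon>-solution from
        \<open>I\<close>, hence safe.\<close>
      case False
      have "norm (x - q) * (1 + 1 / t\<^sub>0) \<le> \<rho> * (1 + 1 / t\<^sub>0)"
        using that t0' by (intro mult_right_mono) auto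
      moreover have "\<rho> * (1 + 1 / t\<^sub>0) \<le> \<delta>" "\<rho> * (1 + 1 / t\<^sub>0) \<le> \<epsilon> / 4"
        using \<rho>(4,5) t0' by (simp_all only: pos_le_divide_eq)
      ultimately have small: "norm (x - q) * (1 + 1 / t\<^sub>0) \<le> \<delta>"
        "norm (x - q) * (1 + 1 / t\<^sub>0) \<le> \<epsilon> / 4" by linarith+
      have "norm (f x' - f (y t)) \<le> \<epsilon> / 8" if "0 \<le> t" "norm (x' - y t) \<le> \<delta>" for t x'
        using osc[OF safe[OF y(3,4) that(1)] that(2)] \<epsilon> by linarith
      then have "y T + (x - q) \<in> reach f \<epsilon> {0..} I"
        using eps_solution_perturb[OF y(3,4) t0(1) _ _ small] False \<epsilon> by simp
      then show ?thesis using y \<epsilon> by auto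
    qed
  qed

  \<comment> \<open>The first entry keeps the Hermite arcs within \<delta>; the others are the
    smallness conditions of the barrier lemma for \<eta> equal to \<open>\<epsilon> / 4\<close>, the
    step freedom available at tolerance \<open>\<epsilon> / 2\<close>.\<close>
  define \<tau> where "\<tau> = Min {\<delta> / (M + \<epsilon>), \<rho> * \<epsilon> / 8 / M\<^sup>2, 4 * \<rho> / \<epsilon>}"
  have \<tau>: "\<tau> > 0" "\<tau> \<le> \<delta> / (M + \<epsilon>)" "\<tau> \<le> \<rho> * \<epsilon> / 8 / M\<^sup>2" "\<tau> \<le> 4 * \<rho> / \<epsilon>"
  proof -
    show "\<tau> > 0" unfolding \<tau>_def using \<delta>(1) \<rho>(1) \<epsilon>(1) \<open>M + \<epsilon> > 0\<close> \<open>M > 0\<close> by simp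
  qed (unfold \<tau>_def, (rule Min_le; simp)+)
  have \<tau>M: "\<tau> * (M + \<epsilon>) \<le> \<delta>" "\<tau> * M\<^sup>2 \<le> \<rho> * (\<epsilon> / 4) / 2" "\<tau> * (\<epsilon> / 4) \<le> \<rho>"
    using \<tau>(2-4) \<open>M > 0\<close> \<epsilon> by (simp_all add: pos_le_divide_eq)
  show ?thesis
  proof (rule barrier_certificate_from_invariant_set[OF \<open>bounded S\<close> \<open>I \<subseteq> S\<close> _ _ _ sep _ \<tau>(1) \<tau>M(2,3)])
    fix q w :: "real ^ 'n" assume q: "q \<in> S" and w: "norm w \<le> \<epsilon> / 4"
    have "norm (f q) \<le> M" using M[OF S_safe[OF q], of q] \<delta> by simp
    then have "\<tau> * (norm (f q) + \<epsilon> / 2) \<le> \<tau> * (M + \<epsilon>)"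
      using \<tau>(1) \<epsilon> by (intro mult_left_mono) auto
    then have "\<tau> * (norm (f q) + \<epsilon> / 2) \<le> \<delta>" using \<tau>M(1) by linarith
    then show "q + \<tau> *\<^sub>R (f q + w) \<in> S"
      unfolding S_def using q w \<epsilon> \<tau>(1) osc[OF S_safe[OF q]]
      by (intro tangent_reach_step[OF assms(2)]) (auto simp: S_def)
  next
    fix q x assume "q \<in> S" "norm (x - q) < \<rho>"
    then show "norm (f x - f q) \<le> \<epsilon> / 4 / 2" "norm (f x) \<le> M"
      using osc[OF S_safe, of q x] M[OF S_safe, of q x] \<rho> \<epsilon> by auto
  qed (use \<epsilon>(1) in simp_all)
qed

end
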